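(* Let $(B,+,\circ)$ be a compact skew left brace and let $\mu$ be its probability Haar measure. Then the following hold. (1) For all $x\in B\setminus\mathrm{Ann}(B)$, $\mu(\mathrm{Cb}_B(x))\leqslant\frac{1}{2}$. (2) If $B\neq\mathrm{Ann}(B)$, then $\mathrm{Pb}(B)\leqslant\frac{3}{4}$. (3) If $|B/\mathrm{Ann}(B)|=d$ is finite, then $\mathrm{Pb}(B)\leqslant\frac{d+1}{2d}$. (4) In particular, if $|B/\mathrm{Ann}(B)|=d\geqslant 3$, then $\mathrm{Pb}(B)\leqslant\frac{5}{8}$. (5) If $B\neq\mathrm{FCI}(B)$, then $\mathrm{Pb}(B)\leqslant\frac{1}{2}$.
   Context: A skew left brace is a set $B$ with two group structures $(B,+)$ and $(B,\circ)$ (neither assumed abelian) such that $a\circ(b+c)=(a\circ b)-a+(a\circ c)$ for all $a,b,c\in B$, where $-a$ is the inverse of $a$ in $(B,+)$. The identities of the two groups coincide and are denoted by $1$. A topological skew left brace is a skew left brace equipped with one topology for which both $(B,+)$ and $(B,\circ)$ are topological groups. "Compact skew left brace" means a topological skew left brace whose topology is compact and Hausdorff. Put $a*b:=-a+(a\circ b)-b$ and $[a,b]^+:=a+b-a-b$. The annihilator of $B$ is $\mathrm{Ann}(B):=\{a\in B\mid a+b=b+a=a\circ b=b\circ a \text{ for all } b\in B\}$, an ideal of $B$. The brace centralizer of $x\in B$ is $\mathrm{Cb}_B(x):=\{b\in B\mid x*b=b*x=[x,b]^+=1\}$; it is a closed subgroup of $(B,\circ)$. $\mathrm{FCI}(B)$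 is the set of all $x\in B$ such that the index $[(B,\circ):\mathrm{Cb}_B(x)]$ is finite. Let $\mu$ be the unique probability Haar measure on $(B,+)$ (it is also the probability Haar measure on $(B,\circ)$), and let $Z:=\{(a,b)\in B\times B\mid a*b=b*a=[a,b]^+=1\}$, a closed subset of $B\times B$. The commuting probability is $\mathrm{Pb}(B):=(\mu\times\mu)(Z)$. *)

theory Defs
  imports "HOL-Probability.Probability_Measure"
begin

section \<open>Skew left braces\<close>

text \<open>The brace is a whole type. Its additive group, which need not be abelian, is the
  \<^class>\<open>group_add\<close> structure of that type; the second group operation is the parameter
  \<open>\<odot>\<close>, with unit \<open>e\<close> and inversion \<open>cinv\<close>.\<close>

locale skew_left_brace = group circ e cinv
  for circ :: "'a::group_add \<Rightarrow> 'a \<Rightarrow> 'a" (infixl "\<odot>" 70) and e :: 'a and cinv :: "'a \<Rightarrow> 'a" +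
  assumes brace: "a \<odot> (b + c) = (a \<odot> b) - a + (a \<odot> c)"
begin

lemma unit_eq_zero: "e = 0"
proof -
  have "0 = e - e + (e \<odot> 0)"
    using group_left_neutral by simp
  moreover have "a \<odot> 0 = a" for a
    using brace[of a 0 0] by (metis add.assoc add.right_neutral add_left_cancel add_minus_cancel
        diff_conv_add_uminus minus_add_cancel)
  ultimately show ?thesis by simp
qed

end

locale compact_skew_left_brace = skew_left_brace circ e cinv
  for circ :: "'a::{topological_group_add, t2_space} \<Rightarrow> 'a \<Rightarrow> 'a" (infixl "\<odot>" 70)
    and e :: 'a and cinv :: "'a \<Rightarrow> 'a" +
  assumes continuous_circ: "continuous_on UNIV (\<lambda>(a, b). a \<odot> b)"
    and continuous_cinv: "continuous_on UNIV cinv"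
    and compact_space: "compact (UNIV :: 'a set)"

definition star :: "('a::group_add \<Rightarrow> 'a \<Rightarrow> 'a) \<Rightarrow> 'a \<Rightarrow> 'a \<Rightarrow> 'a"
  where "star circ a b = - a + circ a b - b"

definition add_commutator :: "'a::group_add \<Rightarrow> 'a \<Rightarrow> 'a"
  where "add_commutator a b = a + b - a - b"

definition Ann :: "('a::group_add \<Rightarrow> 'a \<Rightarrow> 'a) \<Rightarrow> 'a set"
  where "Ann circ = {a. \<forall>b. a + b = b + a \<and> b + a = circ a b \<and> circ a b = circ b a}"

definition Cb :: "('a::group_add \<Rightarrow> 'a \<Rightarrow> 'a) \<Rightarrow> 'a \<Rightarrow> 'a set"
  where "Cb circ x = {b. star circ x b = 0 \<and> star circ b x = 0 \<and> add_commutator x b = 0}"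

definition left_cosets :: "('a \<Rightarrow> 'a \<Rightarrow> 'a) \<Rightarrow> 'a set \<Rightarrow> 'a set set"
  where "left_cosets f H = range (\<lambda>a. f a ` H)"

definition FCI :: "('a::group_add \<Rightarrow> 'a \<Rightarrow> 'a) \<Rightarrow> 'a set"
  where "FCI circ = {x. finite (left_cosets circ (Cb circ x))}"

text \<open>For \<open>z\<close> in the annihilator \<open>a + z = a \<odot> z\<close>, so the additive cosets of the annihilator
  are also its cosets with respect to the second group operation.\<close>

definition Ann_quotient :: "('a::group_add \<Rightarrow> 'a \<Rightarrow> 'a) \<Rightarrow> 'a set set"
  where "Ann_quotient circ = left_cosets (+) (Ann circ)"


section \<open>Haar measure and commuting probability\<close>

definition regular_borel_measure :: "'a::topological_space measure \<Rightarrow> bool"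
  where "regular_borel_measure M \<longleftrightarrow> sets M = sets borel \<and>
    (\<forall>E\<in>sets borel.
      emeasure M E = (INF U\<in>{U. open U \<and> E \<subseteq> U}. emeasure M U) \<and>
      emeasure M E = (SUP K\<in>{K. compact K \<and> K \<subseteq> E}. emeasure M K))"

definition haar_probability_measure :: "'a::topological_group_add measure \<Rightarrow> bool"
  where "haar_probability_measure M \<longleftrightarrow> prob_space M \<and> regular_borel_measure M \<and>
    (\<forall>a. \<forall>E\<in>sets borel. emeasure M ((+) a ` E) = emeasure M E)"

text \<open>If the space is not second countable, the product \<open>\<sigma>\<close>-algebra of \<^term>\<open>M \<Otimes>\<^sub>M N\<close> may be
  strictly smaller than the Borel \<open>\<sigma>\<close>-algebra of the product space, and may miss closed sets
  (to which \<^const>\<open>measure\<close> would then assign 0). The product of two Haar measures is therefore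
  the regular Borel measure on the product space that extends the product measure; the following
  conditions determine it uniquely.\<close>

definition regular_product_measure ::
    "'a::topological_space measure \<Rightarrow> 'b::topological_space measure \<Rightarrow> ('a \<times> 'b) measure \<Rightarrow> bool"
  where "regular_product_measure M N P \<longleftrightarrow> regular_borel_measure P \<and>
    (\<forall>A\<in>sets M. \<forall>B\<in>sets N. emeasure P (A \<times> B) = emeasure M A * emeasure N B)"

definition commuting_pairs :: "('a::group_add \<Rightarrow> 'a \<Rightarrow> 'a) \<Rightarrow> ('a \<times> 'a) set"
  where "commuting_pairs circ =
    {(a, b). star circ a b = 0 \<and> star circ b a = 0 \<and> add_commutator a b = 0}"

text \<open>\<open>P\<close> is meant to be the product of the Haar probability measure with itself.\<close>

definition Pb :: "('a::group_add \<Rightarrow> 'a \<Rightarrow> 'a) \<Rightarrow> ('a \<times> 'a) measure \<Rightarrow> real"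
  where "Pb circ P = measure P (commuting_pairs circ)"

context compact_skew_left_brace
begin

lemma closed_commuting_pairs: "closed (commuting_pairs circ)"
proof -
  have 1: "continuous_on UNIV (\<lambda>p::'a \<times> 'a. fst p \<odot> snd p)"
    using continuous_circ by (simp add: case_prod_unfold)
  have 2: "continuous_on UNIV (\<lambda>p::'a \<times> 'a. snd p \<odot> fst p)"
    using continuous_on_compose2[OF 1 continuous_on_swap] by simp
  have *: "continuous_on UNIV (\<lambda>p::'a \<times> 'a. f p + g p)" "continuous_on UNIV (\<lambda>p::'a \<times> 'a. f p - g p)"
    if "continuous_on UNIV f" "continuous_on UNIV g" for f g :: "'a \<times> 'a \<Rightarrow> 'a"
    using that by (auto simp: continuous_on_def diff_conv_add_uminus simp del: add_uminus_conv_diff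
        intro!: tendsto_add tendsto_minus)
  have **: "continuous_on UNIV (\<lambda>p::'a \<times> 'a. - f p)"
    if "continuous_on UNIV f" for f :: "'a \<times> 'a \<Rightarrow> 'a"
    using that by (auto simp: continuous_on_def intro!: tendsto_minus)
  have "commuting_pairs circ =
      {p. - fst p + fst p \<odot> snd p - snd p = 0} \<inter> {p. - snd p + snd p \<odot> fst p - fst p = 0} \<inter>
      {p. fst p + snd p - fst p - snd p = 0}"
    by (auto simp: commuting_pairs_def star_def add_commutator_def)
  then show ?thesis
    by (auto intro!: closed_Int closed_Collect_eq * ** 1 2 continuous_on_fst continuous_on_snd
        continuous_on_id continuous_on_const)
qed

lemma closed_Cb: "closed (Cb circ x)"
proof -
  have "Cb circ x = Pair x -` commuting_pairs circ"
    by (auto simp: Cb_def commuting_pairs_def)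
  then show ?thesis
    using closed_commuting_pairs
    by (auto intro!: closed_vimage continuous_intros)
qed

end

end

theory Submission
  imports Defs
begin

text \<open>Write \<open>f x\<close> for the measure of the centralizer of \<open>x\<close>, which is the slice over \<open>x\<close> of
  the closed set \<open>Z\<close> of commuting pairs. The centralizers, and the annihilator as their
  intersection, are closed subgroups for \<open>\<odot>\<close>. So everything follows from two principles: a
  bound for the measure of \<open>Z\<close> in terms of its slices, and the invariance of \<open>\<mu>\<close> under left
  \<open>\<odot>\<close>-translations, which makes all cosets of a closed \<open>\<odot>\<close>-subgroup equally large.

  Invariance gives \<open>f x \<le> 1/2\<close> when the centralizer of \<open>x\<close> is proper, that is, when \<open>x\<close> is
  not in the annihilator \<open>A\<close>. Bounding the slices by 1 over \<open>A\<close> and by \<open>1/2\<close> elsewhere, the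
  commuting probability is at most \<open>(1 + \<mu>(A)) / 2\<close>, where \<open>\<mu>(A)\<close> is at most \<open>1/2\<close> if
  \<open>A\<close> is proper and equals \<open>1/d\<close> if \<open>A\<close> has index \<open>d\<close>. For \<open>d \<ge> 4\<close> the resulting bound
  is at most \<open>5/8\<close>. For \<open>d = 3\<close> it is only \<open>2/3\<close>, but then a centralizer is a union of
  cosets of \<open>A\<close>, each of measure \<open>1/3\<close>, so that \<open>f x \<le> 1/2\<close> improves to \<open>f x \<le> 1/3\<close> off
  \<open>A\<close> and the commuting probability is at most \<open>5/9\<close>.
  Finally, \<open>f\<close> vanishes at the elements whose centralizer has infinite index. If \<open>g\<close> is one of
  them, then \<open>E = {x. f x > 0}\<close> and its translate by \<open>g\<close> are disjoint, since the elements with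
  a centralizer of finite index form a subgroup; hence \<open>\<mu>(E) \<le> 1/2\<close>, which bounds the
  commuting probability.

  Haar measure is only assumed to be invariant under additive left translations. But
  \<open>a \<odot> b = a + \<lambda>\<^sub>a b\<close> for an automorphism \<open>\<lambda>\<^sub>a\<close> of the additive group, so \<open>\<odot>\<close>-invariance amounts to
  invariance under automorphisms (\<open>haar_automorphism_invariant\<close>). This is an instance of the
  uniqueness of Haar measure on a compact group: a left invariant and a right invariant
  regular probability measure always coincide (\<open>left_invariant_eq_right_invariant\<close>), by a double
  counting argument. Neither this argument nor the slice bound (\<open>measure_le_by_slices\<close>) can use
  Fubini's theorem, because without second countability the sets in question need not belong to
  the product \<open>\<sigma>\<close>-algebra. Both replace it by finite sums, with partitions provided by the tube
  lemma and compactness.\<close>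

section \<open>Cosets of a subgroup and an invariant probability measure\<close>

locale subgroup_of = group f z inverse
  for f :: "'a \<Rightarrow> 'a \<Rightarrow> 'a" (infixl "\<cdot>" 70) and z :: 'a and inverse :: "'a \<Rightarrow> 'a" +
  fixes H :: "'a set"
  assumes unit_mem: "z \<in> H"
    and mult_mem: "a \<in> H \<Longrightarrow> b \<in> H \<Longrightarrow> a \<cdot> b \<in> H"
    and inverse_mem: "a \<in> H \<Longrightarrow> inverse a \<in> H"
begin

lemma mem_coset_self: "a \<in> f a ` H"
  by (rule image_eqI[OF _ unit_mem]) simp

lemma coset_eq:
  assumes "b \<in> f a ` H"
  shows "f b ` H = f a ` H"
proof -
  obtain h where h: "h \<in> H" "b = a \<cdot> h"
    using assms by blast
  have "f b ` H \<subseteq> f a ` H"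
    using h mult_mem by (auto simp: assoc)
  moreover have "f a ` H \<subseteq> f b ` H"
  proof (rule image_subsetI)
    fix k
    assume "k \<in> H"
    have "a \<cdot> k = b \<cdot> (inverse h \<cdot> k)"
      unfolding h(2) by (metis assoc right_inverse group_left_neutral)
    then show "a \<cdot> k \<in> f b ` H"
      using \<open>k \<in> H\<close> h(1) by (intro image_eqI[OF _ mult_mem[OF inverse_mem]])
  qed
  ultimately show ?thesis
    by (rule subset_antisym)
qed

lemma disjoint_left_cosets: "disjoint (left_cosets f H)"
  unfolding disjoint_def left_cosets_def using coset_eq by blast

text \<open>Each coset of \<open>K\<close> is obtained from a coset of \<open>H\<close> by saturation.\<close>

lemma finite_left_cosets_mono:
  assumes "subgroup_of f z inverse K" and "H \<subseteq> K" and "finite (left_cosets f H)"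
  shows "finite (left_cosets f K)"
proof -
  interpret K: subgroup_of f z inverse K by fact
  have union: "f a ` K = (\<Union>c\<in>f a ` H. f c ` K)" for a
  proof -
    have "f c ` K = f a ` K" if "c \<in> f a ` H" for c
      using that \<open>H \<subseteq> K\<close> by (intro K.coset_eq) (rule subsetD[OF image_mono])
    then have "(\<Union>c\<in>f a ` H. f c ` K) = (\<Union>c\<in>f a ` H. f a ` K)"
      by (rule SUP_cong[OF refl])
    also have "\<dots> = f a ` K"
      using unit_mem by (auto simp only: UN_constant split: if_splits)
    finally show ?thesis ..
  qed
  have "f a ` K \<in> (\<lambda>C. \<Union>c\<in>C. f c ` K) ` left_cosets f H" for a
    by (rule image_eqI[where x = "f a ` H"], rule union) (simp add: left_cosets_def)
  then have "left_cosets f K \<subseteq> (\<lambda>C. \<Union>c\<in>C. f c ` K) ` left_cosets f H"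
    unfolding left_cosets_def[of f K] by (rule image_subsetI)
  with assms(3) show ?thesis
    by (rule finite_surj)
qed

text \<open>A coset of \<open>H \<inter> K\<close> is the intersection of a coset of \<open>H\<close> with a coset of \<open>K\<close>.\<close>

lemma finite_left_cosets_Int:
  assumes "finite (left_cosets f H)" and "finite (left_cosets f K)"
  shows "finite (left_cosets f (H \<inter> K))"
proof -
  have Int: "f a ` (H \<inter> K) = f a ` H \<inter> f a ` K" for a
    by (intro image_Int inj_onI) (simp add: left_cancel)
  have "f a ` (H \<inter> K) \<in> (\<lambda>(C, D). C \<inter> D) ` (left_cosets f H \<times> left_cosets f K)" for a
    by (rule image_eqI[of _ _ "(f a ` H, f a ` K)"]) (simp_all add: Int left_cosets_def)
  then have "left_cosets f (H \<inter> K) \<subseteq> (\<lambda>(C, D). C \<inter> D) ` (left_cosets f H \<times> left_cosets f K)"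
    unfolding left_cosets_def[of f "H \<inter> K"] by (rule image_subsetI)
  moreover have "finite ((\<lambda>(C, D). C \<inter> D) ` (left_cosets f H \<times> left_cosets f K))"
    by (intro finite_imageI finite_SigmaI assms)
  ultimately show ?thesis
    by (rule finite_subset)
qed

end

locale invariant_subgroup = subgroup_of f z inverse H + prob_space M
  for f :: "'a \<Rightarrow> 'a \<Rightarrow> 'a" (infixl "\<cdot>" 70) and z :: 'a and inverse :: "'a \<Rightarrow> 'a"
    and H :: "'a set" and M :: "'a measure" +
  assumes coset_sets: "f a ` H \<in> sets M"
    and measure_coset: "measure M (f a ` H) = measure M H"
begin

lemma measure_Union_cosets:
  assumes "finite C" and "C \<subseteq> left_cosets f H"
  shows "measure M (\<Union>C) = card C * measure M H"
proof -
  have "C \<subseteq> sets M"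
    using assms(2) coset_sets by (auto simp: left_cosets_def)
  moreover have "disjoint_family_on (\<lambda>D. D) C"
    using assms(2) disjoint_left_cosets unfolding disjoint_family_on_def disjoint_def
    by (meson subsetD)
  ultimately have "measure M (\<Union>D\<in>C. D) = (\<Sum>D\<in>C. measure M D)"
    using assms(1) by (intro finite_measure_finite_Union) simp_all
  also have "\<dots> = (\<Sum>D\<in>C. measure M H)"
    using assms measure_coset by (intro sum.cong) (auto simp: left_cosets_def)
  finally show ?thesis
    by simp
qed

lemma card_cosets_mult_measure_le:
  assumes "finite C" and "C \<subseteq> left_cosets f H"
  shows "card C * measure M H \<le> 1"
  using measure_Union_cosets[OF assms] prob_le_1 by metis

lemma measure_proper_subgroup_le_half:
  assumes "H \<noteq> UNIV"
  shows "measure M H \<le> 1 / 2"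
proof -
  obtain a where "a \<notin> H"
    using assms by blast
  then have "f a ` H \<noteq> f z ` H"
    using mem_coset_self[of a] by (auto simp: group_left_neutral)
  then have "card {f a ` H, f z ` H} = 2"
    by simp
  moreover have "{f a ` H, f z ` H} \<subseteq> left_cosets f H"
    unfolding left_cosets_def by blast
  ultimately show ?thesis
    using card_cosets_mult_measure_le[of "{f a ` H, f z ` H}"] by simp
qed

lemma measure_infinite_index_eq_0:
  assumes "infinite (left_cosets f H)"
  shows "measure M H = 0"
proof (rule ccontr)
  assume "measure M H \<noteq> 0"
  then have "measure M H > 0"
    by (simp add: zero_less_measure_iff)
  then obtain n where "1 < real n * measure M H"
    using reals_Archimedean3 by blast
  moreover obtain C where "C \<subseteq> left_cosets f H" "finite C" "card C = n"
    using infinite_arbitrarily_large[OF assms] by blast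
  ultimately show False
    using card_cosets_mult_measure_le by fastforce
qed

text \<open>A set that is stable under right multiplication by \<open>H\<close> is the disjoint union of the cosets
  that it contains.\<close>

lemma measure_stable_set:
  assumes "finite (left_cosets f H)" and "\<And>a h. a \<in> S \<Longrightarrow> h \<in> H \<Longrightarrow> a \<cdot> h \<in> S"
  shows "measure M S = card {C \<in> left_cosets f H. C \<subseteq> S} * measure M H"
proof -
  have "a \<in> f a ` H" "f a ` H \<in> {C \<in> left_cosets f H. C \<subseteq> S}" if "a \<in> S" for a
    using that assms(2) mem_coset_self by (auto simp: left_cosets_def)
  then have "S \<subseteq> \<Union>{C \<in> left_cosets f H. C \<subseteq> S}"
    by (intro subsetI UnionI)
  then have "\<Union>{C \<in> left_cosets f H. C \<subseteq> S} = S"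
    by (intro subset_antisym Union_least) simp_all
  then show ?thesis
    using measure_Union_cosets[of "{C \<in> left_cosets f H. C \<subseteq> S}"] assms(1) by simp
qed

lemma card_left_cosets_mult_measure:
  assumes "finite (left_cosets f H)" and "space M = UNIV"
  shows "card (left_cosets f H) * measure M H = 1"
  using measure_stable_set[of UNIV] assms prob_space by simp

end

section \<open>Inner regular measures\<close>

text \<open>For a finite measure on a Hausdorff space this is all that regularity amounts to, because
  outer regularity follows by taking complements. In terms of real numbers and \<open>\<epsilon>\<close>, it is easy
  to transport along continuous maps.\<close>

definition inner_regular :: "'a::topological_space measure \<Rightarrow> bool"
  where "inner_regular M \<longleftrightarrow> sets M = sets borel \<and>
    (\<forall>E\<in>sets borel. \<forall>\<epsilon>>0. \<exists>K. compact K \<and> K \<subseteq> E \<and> measure M E < measure M K + \<epsilon>)"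

lemma inner_regularE:
  assumes "inner_regular M" and "E \<in> sets borel" and "\<epsilon> > 0"
  obtains K where "compact K" "K \<subseteq> E" "measure M E < measure M K + \<epsilon>"
  using assms unfolding inner_regular_def by blast

lemma regular_borel_imp_inner_regular:
  assumes "finite_measure M" and "regular_borel_measure M"
  shows "inner_regular M"
  unfolding inner_regular_def
proof (intro conjI ballI allI impI)
  interpret finite_measure M by fact
  show "sets M = sets borel"
    using assms(2) by (simp add: regular_borel_measure_def)
  fix E :: "'a set" and \<epsilon> :: real
  assume E: "E \<in> sets borel" and "\<epsilon> > 0"
  show "\<exists>K. compact K \<and> K \<subseteq> E \<and> measure M E < measure M K + \<epsilon>"
  proof (cases "measure M E < \<epsilon>")
    case True
    then show ?thesis
      by (intro exI[of _ "{}"]) simp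
  next
    case False
    with \<open>\<epsilon> > 0\<close> have "ennreal (measure M E - \<epsilon>) < emeasure M E"
      by (simp add: emeasure_eq_measure ennreal_less_iff)
    also have "emeasure M E = (SUP K\<in>{K. compact K \<and> K \<subseteq> E}. emeasure M K)"
      using assms(2) E unfolding regular_borel_measure_def by blast
    finally obtain K where "compact K" "K \<subseteq> E" "ennreal (measure M E - \<epsilon>) < emeasure M K"
      unfolding less_SUP_iff by blast
    with False show ?thesis
      by (intro exI[of _ K]) (simp add: emeasure_eq_measure ennreal_less_iff)
  qed
qed

lemma measure_Compl_borel:
  assumes "prob_space M" and "sets M = sets borel" and "E \<in> sets borel"
  shows "measure M (- E) = 1 - measure M E"
proof -
  interpret prob_space M by fact
  have "space M = UNIV"
    using assms(2) sets_eq_imp_space_eq[of M borel] by simp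
  then show ?thesis
    using prob_compl[of E] assms by (simp add: Compl_eq_Diff_UNIV)
qed

lemma inner_regular_outerE:
  fixes M :: "'a::t2_space measure"
  assumes "prob_space M" and "inner_regular M" and "E \<in> sets borel" and "\<epsilon> > 0"
  obtains U where "open U" "E \<subseteq> U" "measure M U < measure M E + \<epsilon>"
proof -
  have sets: "sets M = sets borel"
    using assms(2) by (simp add: inner_regular_def)
  obtain K where K: "compact K" "K \<subseteq> - E" "measure M (- E) < measure M K + \<epsilon>"
    using inner_regularE[OF assms(2), of "- E" \<epsilon>] assms by auto
  then have "closed K"
    by (simp add: compact_imp_closed)
  with K assms sets show ?thesis
    by (intro that[of "- K"]) (auto simp: measure_Compl_borel)
qed

text \<open>If \<open>K\<close> is compact inside the preimage of \<open>E\<close>, then \<open>g ` K\<close> is compact inside \<open>E\<close>, and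
  its preimage is at least as large as \<open>K\<close>.\<close>

lemma inner_regular_distr:
  fixes g :: "'a::t2_space \<Rightarrow> 'b::t2_space"
  assumes "finite_measure M" and "inner_regular M" and g: "continuous_on UNIV g"
  shows "inner_regular (distr M borel g)"
  unfolding inner_regular_def
proof (intro conjI ballI allI impI)
  interpret finite_measure M by fact
  have sets[measurable_cong]: "sets M = sets borel"
    using assms(2) by (simp add: inner_regular_def)
  have space: "space M = UNIV"
    using sets_eq_imp_space_eq[OF sets] by simp
  have [measurable]: "g \<in> borel_measurable M"
    using borel_measurable_continuous_onI[OF g] sets by (simp cong: measurable_cong_sets)
  fix E :: "'b set" and \<epsilon> :: real
  assume E: "E \<in> sets borel" and "\<epsilon> > 0"
  have gE: "g -` E \<in> sets borel"
    using measurable_sets[OF borel_measurable_continuous_onI[OF g] E] by simp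
  obtain K where K: "compact K" "K \<subseteq> g -` E" "measure M (g -` E) < measure M K + \<epsilon>"
    using inner_regularE[OF assms(2) gE \<open>\<epsilon> > 0\<close>] by blast
  have gK: "compact (g ` K)"
    using K g compact_continuous_image continuous_on_subset by blast
  then have gK_sets: "g ` K \<in> sets borel"
    by (simp add: compact_imp_closed)
  have "g -` g ` K \<in> sets M"
    using measurable_sets[OF borel_measurable_continuous_onI[OF g] gK_sets] sets by simp
  then have "measure M K \<le> measure M (g -` g ` K)"
    by (intro finite_measure_mono) auto
  with K gK gK_sets E show "\<exists>K. compact K \<and> K \<subseteq> E \<and> measure (distr M borel g) E < measure (distr M borel g) K + \<epsilon>"
    by (intro exI[of _ "g ` K"]) (auto simp: measure_distr space)
qed simp

text \<open>The tube lemma and compactness yield finite open covers; counting arguments need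
  disjoint pieces.\<close>

lemma finite_cover_partition:
  assumes "finite D" and "K \<in> sets M" and "\<And>c. c \<in> D \<Longrightarrow> V c \<in> sets M" and "K \<subseteq> (\<Union>c\<in>D. V c)"
  obtains W where "\<forall>c\<in>D. W c \<in> sets M" "\<forall>c\<in>D. W c \<subseteq> V c"
    "disjoint_family_on W D" "(\<Union>c\<in>D. W c) = K"
  using assms
proof (induction D arbitrary: K thesis rule: finite_induct)
  case empty
  then show ?case
    by (auto simp: disjoint_family_on_def)
next
  case (insert c D)
  obtain W where W: "\<forall>d\<in>D. W d \<in> sets M" "\<forall>d\<in>D. W d \<subseteq> V d"
    "disjoint_family_on W D" "(\<Union>d\<in>D. W d) = K - V c"
    by (rule insert.IH[of "K - V c"]) (use insert.prems in auto)
  let ?W = "W(c := K \<inter> V c)"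
  have eq: "?W d = W d" if "d \<in> D" for d
    using that insert.hyps by auto
  then have Union_eq: "(\<Union>d\<in>D. ?W d) = K - V c"
    using W(4) by (metis (no_types, lifting) SUP_cong)
  show ?case
  proof (rule insert.prems(1)[of ?W])
    show "\<forall>d\<in>insert c D. ?W d \<in> sets M" "\<forall>d\<in>insert c D. ?W d \<subseteq> V d"
      using W insert.prems by auto
    have "disjoint_family_on ?W D"
      using W(3) eq by (simp add: disjoint_family_on_def)
    moreover have "?W c \<inter> (\<Union>d\<in>D. ?W d) = {}"
      unfolding Union_eq by auto
    ultimately show "disjoint_family_on ?W (insert c D)"
      using insert.hyps by (simp add: disjoint_family_on_insert)
    show "(\<Union>d\<in>insert c D. ?W d) = K"
      unfolding UN_insert Union_eq by auto
  qed
qed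

section \<open>Slices of closed sets in a product\<close>

text \<open>The measure \<open>P\<close> lives on all Borel sets of the product, which may be more than the product
  \<open>\<sigma>\<close>-algebra. Its values on rectangles suffice to bound it on closed sets.\<close>

locale compact_product_measure = M: prob_space M + N: prob_space N
  for M :: "'a::t2_space measure" and N :: "'b::t2_space measure" +
  fixes P :: "('a \<times> 'b) measure"
  assumes inner_M: "inner_regular M" and inner_N: "inner_regular N"
    and sets_P: "sets P = sets borel"
    and rectangle: "A \<in> sets borel \<Longrightarrow> B \<in> sets borel \<Longrightarrow>
      measure P (A \<times> B) = measure M A * measure N B"
    and finite_P: "finite_measure P"
    and compact_snd: "compact (UNIV :: 'b set)"
begin

sublocale P: finite_measure P
  by (rule finite_P)

lemma sets_M: "sets M = sets borel" and sets_N: "sets N = sets borel"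
  using inner_M inner_N by (simp_all add: inner_regular_def)

lemma strip_sets: "A \<in> sets borel \<Longrightarrow> A \<times> UNIV \<in> sets P"
  unfolding sets_P by (intro borel_Times) simp_all

lemma closed_slice: "closed Z \<Longrightarrow> closed (Pair x -` Z)"
  by (intro closed_vimage continuous_intros)

text \<open>Outer regularity encloses the slice over \<open>x\<close> in an open set \<open>U\<close> of almost the same
  measure; compactness of the second factor lets \<open>U\<close> contain the slices over a whole
  neighbourhood of \<open>x\<close>.\<close>

lemma slice_tube:
  assumes "closed Z" and "measure N (Pair x -` Z) < t"
  obtains V U where "open V" "x \<in> V" "open U" "Z \<inter> V \<times> UNIV \<subseteq> V \<times> U" "measure N U < t"
proof -
  have slice: "Pair x -` Z \<in> sets borel"
    by (rule borel_closed[OF closed_slice[OF assms(1)]])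
  have "0 < t - measure N (Pair x -` Z)"
    using assms(2) by simp
  then obtain U where "open U" "Pair x -` Z \<subseteq> U"
    and "measure N U < measure N (Pair x -` Z) + (t - measure N (Pair x -` Z))"
    by (rule inner_regular_outerE[OF N.prob_space_axioms inner_N slice])
  then have U: "open U" "Pair x -` Z \<subseteq> U" "measure N U < t"
    by simp_all
  have "open (- Z \<union> UNIV \<times> U)"
    using assms U by (auto intro!: open_Un open_Times)
  moreover have "{x} \<times> UNIV \<subseteq> - Z \<union> UNIV \<times> U"
    using U by auto
  ultimately have "\<exists>V. x \<in> V \<and> open V \<and> V \<times> UNIV \<subseteq> - Z \<union> UNIV \<times> U"
    by (rule Elementary_Topology.tube_lemma[OF compact_snd])
  then obtain V where "x \<in> V" "open V" "V \<times> UNIV \<subseteq> - Z \<union> UNIV \<times> U"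
    by (elim exE conjE)
  with U show ?thesis
    by (intro that[of V U]) auto
qed

text \<open>Upper semicontinuity of the slice measure, the source of the measurability needed when
  the base is split according to the size of the slices.\<close>

lemma open_slice_less:
  assumes "closed Z"
  shows "open {x. measure N (Pair x -` Z) < t}"
proof (rule open_subopen[THEN iffD2], rule ballI)
  fix x
  assume "x \<in> {x. measure N (Pair x -` Z) < t}"
  then have "measure N (Pair x -` Z) < t"
    by simp
  then obtain V U where VU: "open V" "x \<in> V" "open U" "Z \<inter> V \<times> UNIV \<subseteq> V \<times> U" "measure N U < t"
    by (rule slice_tube[OF assms])
  have "measure N (Pair y -` Z) \<le> measure N U" if "y \<in> V" for y
    using VU that by (intro N.finite_measure_mono) (auto simp: sets_N)
  with VU show "\<exists>T. open T \<and> x \<in> T \<and> T \<subseteq> {x. measure N (Pair x -` Z) < t}"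
    by (intro exI[of _ V]) force
qed

text \<open>Finitely many tubes cover the part of \<open>Z\<close> over \<open>K\<close>. Cutting their bases down to a
  partition of \<open>K\<close> encloses it in disjoint rectangles whose second sides all have measure less
  than \<open>t + \<epsilon>\<close>.\<close>

lemma measure_over_compact_le:
  assumes "closed Z" and "compact K" and "\<And>x. x \<in> K \<Longrightarrow> measure N (Pair x -` Z) \<le> t"
  shows "measure P (Z \<inter> K \<times> UNIV) \<le> t * measure M K"
proof (rule field_le_epsilon)
  fix \<epsilon> :: real
  assume "\<epsilon> > 0"
  have "\<forall>x\<in>K. \<exists>V U. open V \<and> x \<in> V \<and> open U \<and> Z \<inter> V \<times> UNIV \<subseteq> V \<times> U \<and> measure N U < t + \<epsilon>"
  proof
    fix x
    assume "x \<in> K"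
    then have "measure N (Pair x -` Z) < t + \<epsilon>"
      using assms(3)[of x] \<open>\<epsilon> > 0\<close> by simp
    then obtain V U where "open V" "x \<in> V" "open U" "Z \<inter> V \<times> UNIV \<subseteq> V \<times> U" "measure N U < t + \<epsilon>"
      by (rule slice_tube[OF assms(1)])
    then show "\<exists>V U. open V \<and> x \<in> V \<and> open U \<and> Z \<inter> V \<times> UNIV \<subseteq> V \<times> U \<and> measure N U < t + \<epsilon>"
      by (intro exI conjI)
  qed
  then obtain V U where VU: "\<And>x. x \<in> K \<Longrightarrow> open (V x)" "\<And>x. x \<in> K \<Longrightarrow> x \<in> V x"
      "\<And>x. x \<in> K \<Longrightarrow> open (U x)" "\<And>x. x \<in> K \<Longrightarrow> Z \<inter> V x \<times> UNIV \<subseteq> V x \<times> U x"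
      "\<And>x. x \<in> K \<Longrightarrow> measure N (U x) < t + \<epsilon>"
    by metis
  from VU(2) have "K \<subseteq> (\<Union>c\<in>K. V c)"
    by blast
  with \<open>compact K\<close> VU(1) obtain D where D: "D \<subseteq> K" "finite D" "K \<subseteq> (\<Union>c\<in>D. V c)"
    by (rule compactE_image)
  have "K \<in> sets M"
    using \<open>compact K\<close> by (simp add: sets_M compact_imp_closed)
  moreover have "V c \<in> sets M" if "c \<in> D" for c
    using that D VU by (auto simp: sets_M)
  ultimately obtain W where W: "\<forall>c\<in>D. W c \<in> sets M" "\<forall>c\<in>D. W c \<subseteq> V c"
      "disjoint_family_on W D" "(\<Union>c\<in>D. W c) = K"
    by (rule finite_cover_partition[OF D(2) _ _ D(3)])
  have W_borel: "W c \<in> sets borel" if "c \<in> D" for c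
    using W(1) that sets_M by simp
  have U_borel: "U c \<in> sets borel" if "c \<in> D" for c
    by (rule borel_open[OF VU(3)[OF subsetD[OF D(1) that]]])
  have WU: "W c \<times> U c \<in> sets P" if "c \<in> D" for c
    using borel_Times[OF W_borel U_borel] that by (simp add: sets_P)
  have "Z \<inter> K \<times> UNIV \<subseteq> (\<Union>c\<in>D. W c \<times> U c)"
  proof
    fix p
    assume p: "p \<in> Z \<inter> K \<times> UNIV"
    then obtain c where c: "c \<in> D" "fst p \<in> W c"
      using W(4) by (auto simp: mem_Times_iff)
    then have "p \<in> Z \<inter> V c \<times> UNIV"
      using p W(2) by (auto simp: mem_Times_iff)
    moreover have "c \<in> K"
      using c(1) D(1) by blast
    ultimately have "p \<in> V c \<times> U c"
      using VU(4) by blast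
    with c show "p \<in> (\<Union>c\<in>D. W c \<times> U c)"
      by (auto simp: mem_Times_iff)
  qed
  then have "measure P (Z \<inter> K \<times> UNIV) \<le> measure P (\<Union>c\<in>D. W c \<times> U c)"
    using WU D(2) by (intro P.finite_measure_mono) auto
  also have "\<dots> \<le> (\<Sum>c\<in>D. measure P (W c \<times> U c))"
    using WU D(2) by (intro P.finite_measure_subadditive_finite) auto
  also have "\<dots> = (\<Sum>c\<in>D. measure M (W c) * measure N (U c))"
    by (intro sum.cong refl rectangle W_borel U_borel)
  also have "\<dots> \<le> (\<Sum>c\<in>D. measure M (W c) * (t + \<epsilon>))"
    using D(1) by (intro sum_mono mult_left_mono less_imp_le[OF VU(5)] measure_nonneg) (rule subsetD)
  also have "\<dots> = measure M K * (t + \<epsilon>)"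
    using M.finite_measure_finite_Union[OF D(2) _ W(3)] W(1,4)
    by (simp add: image_subset_iff flip: sum_distrib_right)
  also have "\<dots> \<le> t * measure M K + \<epsilon>"
    using M.prob_le_1[of K] \<open>\<epsilon> > 0\<close> by (simp add: algebra_simps mult_left_le)
  finally show "measure P (Z \<inter> K \<times> UNIV) \<le> t * measure M K + \<epsilon>" .
qed

lemma measure_over_borel_le:
  assumes "closed Z" and E: "E \<in> sets borel" and "\<And>x. x \<in> E \<Longrightarrow> measure N (Pair x -` Z) \<le> t"
    and "0 \<le> t"
  shows "measure P (Z \<inter> E \<times> UNIV) \<le> t * measure M E"
proof (rule field_le_epsilon)
  fix \<epsilon> :: real
  assume "\<epsilon> > 0"
  obtain K where K: "compact K" "K \<subseteq> E" "measure M E < measure M K + \<epsilon>"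
    using inner_regularE[OF inner_M E \<open>\<epsilon> > 0\<close>] by blast
  have K_sets: "K \<in> sets borel"
    using K by (simp add: compact_imp_closed)
  have Z_sets: "Z \<in> sets P"
    using assms(1) by (simp add: sets_P)
  have "measure P (Z \<inter> E \<times> UNIV) \<le> measure P (Z \<inter> K \<times> UNIV \<union> (E - K) \<times> UNIV)"
    using K_sets E Z_sets
    by (intro P.finite_measure_mono sets.Un sets.Int strip_sets sets.Diff) auto
  also have "\<dots> \<le> measure P (Z \<inter> K \<times> UNIV) + measure P ((E - K) \<times> UNIV)"
    using K_sets E Z_sets
    by (intro measure_Un_le sets.Int strip_sets sets.Diff) auto
  also have "measure P (Z \<inter> K \<times> UNIV) \<le> t * measure M K"
    using assms K by (intro measure_over_compact_le) auto
  also have "measure P ((E - K) \<times> UNIV) \<le> measure M (E - K)"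
    using K_sets E rectangle[of "E - K" UNIV] by (simp add: mult_left_le)
  also have "measure M (E - K) = measure M E - measure M K"
    using K K_sets E by (intro M.finite_measure_Diff) (auto simp: sets_M)
  also have "t * measure M K \<le> t * measure M E"
    using K E \<open>0 \<le> t\<close> by (intro mult_left_mono M.finite_measure_mono) (auto simp: sets_M)
  finally show "measure P (Z \<inter> E \<times> UNIV) \<le> t * measure M E + \<epsilon>"
    using K by simp
qed

lemma measure_le_by_slices:
  assumes "closed Z" and E: "E \<in> sets borel" and "\<And>x. x \<notin> E \<Longrightarrow> measure N (Pair x -` Z) \<le> t"
    and "0 \<le> t"
  shows "measure P Z \<le> measure M E + t * (1 - measure M E)"
proof -
  have Z_sets: "Z \<in> sets P"
    using assms(1) by (simp add: sets_P)
  have "measure P Z \<le> measure P (Z \<inter> E \<times> UNIV \<union> Z \<inter> (- E) \<times> UNIV)"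
    using E Z_sets by (intro P.finite_measure_mono sets.Un sets.Int strip_sets) auto
  also have "\<dots> \<le> measure P (Z \<inter> E \<times> UNIV) + measure P (Z \<inter> (- E) \<times> UNIV)"
    using E Z_sets by (intro measure_Un_le sets.Int strip_sets) auto
  also have "measure P (Z \<inter> E \<times> UNIV) \<le> 1 * measure M E"
    using assms by (intro measure_over_borel_le) auto
  also have "measure P (Z \<inter> (- E) \<times> UNIV) \<le> t * measure M (- E)"
    using assms by (intro measure_over_borel_le) auto
  finally show ?thesis
    using measure_Compl_borel[OF M.prob_space_axioms sets_M E] by simp
qed

end

section \<open>Haar measure is invariant under automorphisms\<close>

text \<open>Cut the group into small pieces \<open>W c\<close>, each near a point \<open>c\<close>, and
  average over \<open>y\<close> with respect to \<open>L\<close> the total \<open>R\<close>-measure of the pieces with \<open>c + y \<in> K\<close>. By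
  left invariance of \<open>L\<close>, the piece \<open>W c\<close> contributes \<open>R (W c) * L K\<close>, so the average is \<open>L K\<close>.
  On the other hand, for each \<open>y\<close> the pieces in question are contained in a right
  translate of \<open>U\<close>, so that the average is at most \<open>R U\<close>.\<close>

lemma left_invariant_le_right_invariant:
  fixes L R :: "'a::{topological_group_add, t2_space} measure"
  assumes "prob_space L" and "prob_space R" and sets_L: "sets L = sets borel" and sets_R: "sets R = sets borel"
    and left: "\<And>a E. E \<in> sets borel \<Longrightarrow> measure L {x. a + x \<in> E} = measure L E"
    and right: "\<And>a E. E \<in> sets borel \<Longrightarrow> measure R {x. x + a \<in> E} = measure R E"
    and compact_space: "compact (UNIV :: 'a set)"
    and K: "compact K" and U: "open U" and "K \<subseteq> U"
  shows "measure L K \<le> measure R U"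
proof -
  interpret L: prob_space L by fact
  interpret R: prob_space R by fact
  have space: "space L = UNIV" "space R = UNIV"
    using sets_eq_imp_space_eq[OF sets_L] sets_eq_imp_space_eq[OF sets_R] by simp_all
  have cont: "continuous_on UNIV (\<lambda>p::'a \<times> 'a. fst p + snd p)"
    by (intro continuous_intros)
  have cont1: "continuous_on UNIV (\<lambda>x::'a. a + x)" "continuous_on UNIV (\<lambda>x::'a. x + a)" for a
    by (intro continuous_intros)+
  obtain N where N: "0 \<in> N" "open N" "N \<times> K \<subseteq> {p. fst p + snd p \<in> U}"
  proof -
    have "open {p::'a \<times> 'a. fst p + snd p \<in> U}"
      using open_vimage[OF U cont] by (simp add: vimage_def)
    moreover have "{0} \<times> K \<subseteq> {p. fst p + snd p \<in> U}"
      using \<open>K \<subseteq> U\<close> by auto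
    ultimately have "\<exists>N. 0 \<in> N \<and> open N \<and> N \<times> K \<subseteq> {p. fst p + snd p \<in> U}"
      by (rule Elementary_Topology.tube_lemma[OF K])
    then show ?thesis
      using that by (elim exE conjE)
  qed
  define V where "V c = {x. x + (- c) \<in> N}" for c
  have V: "open (V c)" "c \<in> V c" for c
    using open_vimage[OF N(2) cont1(2)[of "- c"]] N(1) by (auto simp: V_def vimage_def)
  from V(2) have "UNIV \<subseteq> (\<Union>c. V c)"
    by blast
  with compact_space V(1) obtain D where D: "finite D" "UNIV \<subseteq> (\<Union>c\<in>D. V c)"
    by (rule compactE_image)
  obtain W where W: "\<forall>c\<in>D. W c \<in> sets R" "\<forall>c\<in>D. W c \<subseteq> V c"
      "disjoint_family_on W D" "(\<Union>c\<in>D. W c) = UNIV"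
  proof (rule finite_cover_partition[OF D(1) _ _ D(2)])
    show "UNIV \<in> sets R" "V c \<in> sets R" for c
      using V by (auto simp: sets_R)
  qed
  have K_sets: "K \<in> sets borel"
    using K by (simp add: compact_imp_closed)
  have K_translate: "{y. c + y \<in> K} \<in> sets L" for c
    using closed_vimage[OF compact_imp_closed[OF K] cont1(1)[of c]] by (simp add: vimage_def sets_L)
  have U_translate: "{x. x + y \<in> U} \<in> sets R" for y
    using open_vimage[OF U cont1(2)[of y]] by (simp add: vimage_def sets_R)
  \<comment> \<open>With \<open>y\<close> fixed, the pieces \<open>W c\<close> counted here lie in \<open>U - y\<close>: if \<open>x \<in> W c\<close> and
    \<open>c + y \<in> K\<close>, then \<open>x + y = (x - c) + (c + y) \<in> N + K\<close>.\<close>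
  have pointwise: "(\<Sum>c\<in>D. measure R (W c) * indicator {y. c + y \<in> K} y) \<le> measure R U" for y
  proof -
    let ?D = "{c \<in> D. c + y \<in> K}"
    have "(\<Sum>c\<in>D. measure R (W c) * indicator {y. c + y \<in> K} y) = (\<Sum>c\<in>?D. measure R (W c))"
      using D(1) by (intro sum.mono_neutral_cong_right) (auto simp: indicator_def)
    also have "\<dots> = measure R (\<Union>c\<in>?D. W c)"
      using W D(1) by (intro R.finite_measure_finite_Union[symmetric])
        (auto intro: disjoint_family_on_mono[of ?D D])
    also have "\<dots> \<le> measure R {x. x + y \<in> U}"
    proof (rule R.finite_measure_mono[OF _ U_translate], rule subsetI)
      fix x
      assume "x \<in> (\<Union>c\<in>?D. W c)"
      then obtain c where c: "c \<in> D" "c + y \<in> K" "x \<in> W c"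
        by blast
      then have "x - c \<in> N"
        using W(2) by (auto simp: V_def)
      with c N(3) have "(x - c) + (c + y) \<in> U"
        by auto
      moreover have "(x - c) + (c + y) = x + y"
        by (metis add.assoc diff_add_cancel)
      ultimately show "x \<in> {x. x + y \<in> U}"
        by simp
    qed
    also have "\<dots> = measure R U"
      using U by (intro right) simp
    finally show ?thesis .
  qed
  have "(\<Sum>c\<in>D. measure R (W c)) = 1"
    using R.finite_measure_finite_Union[OF D(1) _ W(3)] W R.prob_space space by auto
  then have "measure L K = (\<Sum>c\<in>D. measure R (W c) * measure L K)"
    by (simp flip: sum_distrib_right)
  also have "\<dots> = (\<Sum>c\<in>D. measure R (W c) * measure L {y. c + y \<in> K})"
    using left[OF K_sets] by simp
  also have "\<dots> = (\<integral>y. (\<Sum>c\<in>D. measure R (W c) * indicator {y. c + y \<in> K} y) \<partial>L)"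
    using K_translate space by (subst Bochner_Integration.integral_sum) (auto simp: L.emeasure_eq_measure)
  also have "\<dots> \<le> (\<integral>y. measure R U \<partial>L)"
    using K_translate pointwise
    by (intro integral_mono Bochner_Integration.integrable_sum integrable_mult_right)
      (auto simp: L.emeasure_eq_measure)
  finally show ?thesis
    using L.prob_space by simp
qed

lemma left_invariant_eq_right_invariant:
  fixes L R :: "'a::{topological_group_add, t2_space} measure"
  assumes "prob_space L" and "prob_space R" and L: "inner_regular L" and R: "inner_regular R"
    and left: "\<And>a E. E \<in> sets borel \<Longrightarrow> measure L {x. a + x \<in> E} = measure L E"
    and right: "\<And>a E. E \<in> sets borel \<Longrightarrow> measure R {x. x + a \<in> E} = measure R E"
    and compact_space: "compact (UNIV :: 'a set)"
    and E: "E \<in> sets borel"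
  shows "measure L E = measure R E"
proof -
  have sets: "sets L = sets borel" "sets R = sets borel"
    using L R by (simp_all add: inner_regular_def)
  have le: "measure L F \<le> measure R F" if F: "F \<in> sets borel" for F
  proof (rule field_le_epsilon)
    fix \<epsilon> :: real
    assume "\<epsilon> > 0"
    then have "\<epsilon> / 2 > 0"
      by simp
    obtain K where K: "compact K" "K \<subseteq> F" "measure L F < measure L K + \<epsilon> / 2"
      using inner_regularE[OF L F \<open>\<epsilon> / 2 > 0\<close>] by blast
    obtain U where U: "open U" "F \<subseteq> U" "measure R U < measure R F + \<epsilon> / 2"
      using inner_regular_outerE[OF assms(2) R F \<open>\<epsilon> / 2 > 0\<close>] by blast
    have "measure L K \<le> measure R U"
      using K U by (intro left_invariant_le_right_invariant[OF assms(1,2) sets left right compact_space]) auto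
    with K U show "measure L F \<le> measure R F + \<epsilon>"
      by simp
  qed
  have "measure L (- E) = 1 - measure L E" "measure R (- E) = 1 - measure R E"
    using measure_Compl_borel assms(1,2) sets E by blast+
  then show ?thesis
    using le[OF E] le[of "- E"] E by simp
qed

lemma haar_left_invariant:
  fixes \<mu> :: "'a::{topological_group_add, t2_space} measure"
  assumes "haar_probability_measure \<mu>" and "E \<in> sets borel"
  shows "measure \<mu> {x. a + x \<in> E} = measure \<mu> E"
proof -
  have "{x. a + x \<in> E} = (+) (- a) ` E"
    by (auto intro!: image_eqI[where x = "a + _"] simp flip: add.assoc)
  then show ?thesis
    using assms by (simp add: haar_probability_measure_def measure_def)
qed

text \<open>The image \<open>R\<close> of \<open>\<mu>\<close> under negation is right invariant, hence equal to any
  regular left invariant probability measure; both \<open>\<mu>\<close> and its image under \<open>g\<close> are left invariant.\<close>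

lemma haar_automorphism_invariant:
  fixes \<mu> :: "'a::{topological_group_add, t2_space} measure"
  assumes haar: "haar_probability_measure \<mu>" and compact_space: "compact (UNIV :: 'a set)"
    and g: "continuous_on UNIV g" and hom: "\<And>x y. g (x + y) = g x + g y" and "surj g"
    and E: "E \<in> sets borel"
  shows "measure \<mu> (g -` E) = measure \<mu> E"
proof -
  interpret prob_space \<mu>
    using haar by (simp add: haar_probability_measure_def)
  have inner: "inner_regular \<mu>"
    using haar by (intro regular_borel_imp_inner_regular) (auto simp: haar_probability_measure_def finite_measure_axioms)
  have sets: "sets \<mu> = sets borel"
    using inner by (simp add: inner_regular_def)
  have space: "space \<mu> = UNIV"
    using sets_eq_imp_space_eq[OF sets] by simp
  have borel: "h \<in> measurable \<mu> borel" and vimage: "F \<in> sets borel \<Longrightarrow> h -` F \<in> sets borel"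
    if "continuous_on UNIV h" for h :: "'a \<Rightarrow> 'a" and F
    using borel_measurable_continuous_onI[OF that] sets measurable_sets[of h borel borel F]
    by (simp_all cong: measurable_cong_sets)
  have neg: "continuous_on UNIV (uminus :: 'a \<Rightarrow> 'a)"
    by (auto simp: continuous_on_def intro!: tendsto_minus tendsto_ident_at)
  have cont: "continuous_on UNIV (\<lambda>x::'a. a + x)" "continuous_on UNIV (\<lambda>x::'a. x + a)" for a
    by (intro continuous_intros)+
  let ?R = "distr \<mu> borel uminus"
  have R: "prob_space ?R" "inner_regular ?R"
    using borel[OF neg] inner neg by (auto intro!: prob_space_distr inner_regular_distr finite_measure_axioms)
  have R_right: "measure ?R {x. x + a \<in> F} = measure ?R F" if F: "F \<in> sets borel" for a F
  proof -
    have "{x. x + a \<in> F} \<in> sets borel"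
      using vimage[OF cont(2) F] by (simp add: vimage_def)
    then have "measure ?R {x. x + a \<in> F} = measure \<mu> {x. - x + a \<in> F}"
      using borel[OF neg] by (simp add: measure_distr space vimage_def)
    also have "{x. - x + a \<in> F} = {x. - a + x \<in> uminus -` F}"
      by (simp add: minus_add)
    also have "measure \<mu> \<dots> = measure \<mu> (uminus -` F)"
      by (rule haar_left_invariant[OF haar vimage[OF neg F]])
    finally show ?thesis
      using F borel[OF neg] by (simp add: measure_distr space)
  qed
  let ?L = "distr \<mu> borel g"
  have L: "prob_space ?L" "inner_regular ?L"
    using borel[OF g] inner g by (auto intro!: prob_space_distr inner_regular_distr finite_measure_axioms)
  have L_left: "measure ?L {x. a + x \<in> F} = measure ?L F" if F: "F \<in> sets borel" for a F
  proof -
    obtain b where b: "a = g b"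
      using \<open>surj g\<close> by blast
    have "{x. a + x \<in> F} \<in> sets borel"
      using vimage[OF cont(1) F] by (simp add: vimage_def)
    then have "measure ?L {x. a + x \<in> F} = measure \<mu> {x. b + x \<in> g -` F}"
      using borel[OF g] by (simp add: measure_distr space vimage_def b hom)
    also have "\<dots> = measure \<mu> (g -` F)"
      by (rule haar_left_invariant[OF haar vimage[OF g F]])
    finally show ?thesis
      using F borel[OF g] by (simp add: measure_distr space)
  qed
  have "measure \<mu> (g -` E) = measure ?L E"
    using E borel[OF g] by (simp add: measure_distr space)
  also have "\<dots> = measure ?R E"
    by (rule left_invariant_eq_right_invariant[OF L(1) R(1) L(2) R(2) L_left R_right compact_space E])
  also have "\<dots> = measure \<mu> E"
    by (rule left_invariant_eq_right_invariant[OF prob_space_axioms R(1) inner R(2)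
          haar_left_invariant[OF haar] R_right compact_space E, symmetric])
  finally show ?thesis .
qed

section \<open>Centralizers in a skew left brace\<close>

context skew_left_brace
begin

text \<open>The usual \<open>\<lambda>\<close>-map: \<open>a \<mapsto> lam a\<close> is an action of the multiplicative group by
  automorphisms of the additive group.\<close>

definition lam :: "'a \<Rightarrow> 'a \<Rightarrow> 'a"
  where "lam a b = - a + a \<odot> b"

lemma circ_eq_add_lam: "a \<odot> b = a + lam a b"
  by (simp add: lam_def flip: add.assoc)

lemma lam_add: "lam a (b + c) = lam a b + lam a c"
  unfolding lam_def brace by (simp add: add.assoc diff_conv_add_uminus del: add_uminus_conv_diff)

lemma lam_zero: "lam a 0 = 0"
  using lam_add[of a 0 0] by (metis add.right_neutral add_left_cancel)

lemma lam_minus: "lam a (- b) = - lam a b"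
  using lam_add[of a "- b" b] lam_zero[of a] by (simp add: eq_neg_iff_add_eq_0)

lemma lam_circ: "lam (a \<odot> b) c = lam a (lam b c)"
proof -
  have "lam a (lam b c) = - lam a b + lam a (b \<odot> c)"
    by (simp add: lam_def[of b c] lam_add lam_minus)
  also have "\<dots> = - (a \<odot> b) + (a \<odot> b) \<odot> c"
    by (simp add: lam_def[of a] minus_add add.assoc assoc)
  finally show ?thesis
    by (simp add: lam_def)
qed

lemma lam_unit: "lam e b = b"
  using group_left_neutral[of b] by (simp add: lam_def unit_eq_zero)

lemma lam_cinv: "lam a (lam (cinv a) b) = b"
  by (simp add: lam_unit flip: lam_circ)

lemma lam_fix_cinv: "lam a b = b \<Longrightarrow> lam (cinv a) b = b"
  by (metis lam_circ lam_unit left_inverse)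

text \<open>In this form the symmetry between \<open>x\<close> and \<open>b\<close> is visible, and the first two conditions
  can be handled by the action property of \<open>lam\<close>.\<close>

lemma mem_Cb_iff: "b \<in> Cb circ x \<longleftrightarrow> lam x b = b \<and> lam b x = x \<and> x + b = b + x"
proof -
  have "- x + c - b = 0 \<longleftrightarrow> - x + c = b" for x b c :: 'a
    by simp
  moreover have "x + b - x - b = (x + b) - (b + x)"
    by (simp only: diff_conv_add_uminus minus_add add.assoc)
  then have "x + b - x - b = 0 \<longleftrightarrow> x + b = b + x"
    by (simp only: right_minus_eq)
  ultimately show ?thesis
    unfolding Cb_def star_def add_commutator_def lam_def mem_Collect_eq by (simp only:)
qed

lemma mem_Cb_commute: "b \<in> Cb circ x \<longleftrightarrow> x \<in> Cb circ b"
  by (auto simp: mem_Cb_iff)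

lemma Cb_circ_commute:
  assumes "b \<in> Cb circ x"
  shows "x \<odot> b = b \<odot> x"
  using assms by (simp add: mem_Cb_iff circ_eq_add_lam)

text \<open>The map \<open>lam x\<close> fixes \<open>b \<odot> c = b + lam b c\<close> because \<open>x\<close> and \<open>b\<close> commute for \<open>\<odot>\<close>,
  hence so do \<open>lam x\<close> and \<open>lam b\<close>. Given that \<open>lam x\<close> and \<open>lam (b \<odot> c)\<close> fix the respective
  elements, additive and multiplicative commutation are equivalent.\<close>

lemma circ_mem_Cb:
  assumes b: "b \<in> Cb circ x" and c: "c \<in> Cb circ x"
  shows "b \<odot> c \<in> Cb circ x"
proof -
  have 1: "lam (b \<odot> c) x = x"
    using b c by (simp add: lam_circ mem_Cb_iff)
  have "lam x (lam b c) = lam b (lam x c)"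
    using Cb_circ_commute[OF b] by (metis lam_circ)
  then have 2: "lam x (b \<odot> c) = b \<odot> c"
    using b c by (simp add: circ_eq_add_lam[of b c] lam_add mem_Cb_iff)
  have "x \<odot> (b \<odot> c) = (b \<odot> c) \<odot> x"
    by (metis assoc Cb_circ_commute b c)
  with 1 2 show ?thesis
    by (simp add: mem_Cb_iff circ_eq_add_lam[of x] circ_eq_add_lam[of "b \<odot> c"])
qed

lemma cinv_mem_Cb:
  assumes b: "b \<in> Cb circ x"
  shows "cinv b \<in> Cb circ x"
proof -
  have 1: "lam (cinv b) x = x"
    using b by (simp add: lam_fix_cinv mem_Cb_iff)
  have commute: "x \<odot> cinv b = cinv b \<odot> x"
    by (metis Cb_circ_commute[OF b] assoc left_inverse right_inverse group_left_neutral right_neutral)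
  \<comment> \<open>Since \<open>lam x\<close> commutes with \<open>lam (cinv b)\<close> and fixes \<open>b\<close>, it fixes \<open>cinv b\<close> in this form.\<close>
  have cinv_eq: "cinv b = - lam (cinv b) b"
  proof -
    have "cinv b + lam (cinv b) b = 0"
      using left_inverse[of b] by (simp add: circ_eq_add_lam unit_eq_zero)
    then show ?thesis
      by (simp add: eq_neg_iff_add_eq_0)
  qed
  have "lam x (lam (cinv b) b) = lam (cinv b) (lam x b)"
    by (metis commute lam_circ)
  also have "lam x b = b"
    using b by (simp add: mem_Cb_iff)
  finally have 2: "lam x (cinv b) = cinv b"
    by (metis cinv_eq lam_minus)
  from 1 2 commute show ?thesis
    by (simp add: mem_Cb_iff circ_eq_add_lam[of x] circ_eq_add_lam[of "cinv b"])
qed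

lemma unit_mem_Cb: "e \<in> Cb circ x"
  by (simp add: mem_Cb_iff lam_unit) (simp add: unit_eq_zero lam_zero)

lemma subgroup_Cb: "subgroup_of circ e cinv (Cb circ x)"
  by unfold_locales (auto intro: unit_mem_Cb circ_mem_Cb cinv_mem_Cb)

lemma Ann_eq_Inter_Cb: "Ann circ = (\<Inter>x. Cb circ x)"
proof -
  have "a \<in> Ann circ \<longleftrightarrow> (\<forall>x. a \<in> Cb circ x)" for a
  proof -
    have "a + x = x + a \<and> x + a = a \<odot> x \<and> a \<odot> x = x \<odot> a \<longleftrightarrow> a \<in> Cb circ x" for x
      by (auto simp: mem_Cb_iff circ_eq_add_lam) (metis add_left_cancel)+
    then show ?thesis
      by (simp add: Ann_def)
  qed
  then show ?thesis
    by blast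
qed

lemma subgroup_Ann: "subgroup_of circ e cinv (Ann circ)"
  by unfold_locales (auto simp: Ann_eq_Inter_Cb intro: unit_mem_Cb circ_mem_Cb cinv_mem_Cb)

lemma Cb_eq_UNIV_iff: "Cb circ x = UNIV \<longleftrightarrow> x \<in> Ann circ"
  by (auto simp: Ann_eq_Inter_Cb) (use mem_Cb_commute in blast)+

lemma Ann_quotient_eq: "Ann_quotient circ = left_cosets circ (Ann circ)"
proof -
  have "(+) a ` Ann circ = circ a ` Ann circ" for a
    by (intro image_cong) (auto simp: Ann_def)
  then show ?thesis
    by (simp add: Ann_quotient_def left_cosets_def)
qed

text \<open>By symmetry, \<open>b\<close> centralizes \<open>x\<close> and \<open>g \<odot> x\<close> exactly when these lie in the subgroup
  \<open>Cb circ b\<close>, which then contains \<open>g\<close>. So the centralizer of \<open>g\<close> contains an intersection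
  of two subgroups of finite index.\<close>

lemma FCI_of_circ:
  assumes "x \<in> FCI circ" and "g \<odot> x \<in> FCI circ"
  shows "g \<in> FCI circ"
proof -
  interpret x: subgroup_of circ e cinv "Cb circ x"
    by (rule subgroup_Cb)
  interpret gx: subgroup_of circ e cinv "Cb circ (g \<odot> x)"
    by (rule subgroup_Cb)
  interpret I: subgroup_of circ e cinv "Cb circ x \<inter> Cb circ (g \<odot> x)"
    by unfold_locales
      (auto intro: x.unit_mem gx.unit_mem x.mult_mem gx.mult_mem x.inverse_mem gx.inverse_mem)
  have "Cb circ x \<inter> Cb circ (g \<odot> x) \<subseteq> Cb circ g"
  proof
    fix b
    assume "b \<in> Cb circ x \<inter> Cb circ (g \<odot> x)"
    then have x: "x \<in> Cb circ b" and gx: "g \<odot> x \<in> Cb circ b"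
      by (simp_all add: mem_Cb_commute[of b])
    have "(g \<odot> x) \<odot> cinv x \<in> Cb circ b"
      by (rule circ_mem_Cb[OF gx cinv_mem_Cb[OF x]])
    then have "g \<in> Cb circ b"
      by (simp add: assoc)
    then show "b \<in> Cb circ g"
      by (rule mem_Cb_commute[THEN iffD1])
  qed
  moreover have "finite (left_cosets circ (Cb circ x \<inter> Cb circ (g \<odot> x)))"
    using assms by (intro x.finite_left_cosets_Int) (auto simp: FCI_def)
  ultimately show ?thesis
    using I.finite_left_cosets_mono[OF subgroup_Cb] by (auto simp: FCI_def)
qed

end

section \<open>Commuting probability\<close>

context compact_skew_left_brace
begin

lemma continuous_circ_left: "continuous_on UNIV (circ a)"
  using continuous_on_compose2[OF continuous_circ, of UNIV "\<lambda>x. (a, x)"]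
  by (simp add: continuous_on_Pair)

lemma image_circ_eq_vimage: "circ a ` E = circ (cinv a) -` E"
proof -
  have "x = a \<odot> (cinv a \<odot> x)" "cinv a \<odot> (a \<odot> x) = x" for x
    by (simp_all flip: assoc add: group_left_neutral)
  then show ?thesis
    by (auto intro: image_eqI)
qed

lemma image_circ_borel: "E \<in> sets borel \<Longrightarrow> circ a ` E \<in> sets borel"
  using measurable_sets[OF borel_measurable_continuous_onI[OF continuous_circ_left[of "cinv a"]], of E]
  by (simp add: image_circ_eq_vimage)

text \<open>A left \<open>\<odot>\<close>-translation is the composition of the automorphism \<open>lam\<close> and an additive
  translation, both of which preserve Haar measure.\<close>

lemma haar_circ_invariant:
  assumes haar: "haar_probability_measure \<mu>" and E: "E \<in> sets borel"
  shows "measure \<mu> (circ a ` E) = measure \<mu> E"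
proof -
  let ?b = "cinv a"
  have "continuous_on UNIV (lam ?b)"
    unfolding lam_def by (intro continuous_on_add continuous_on_const continuous_circ_left)
  moreover have "surj (lam ?b)"
    by (metis lam_cinv surjI)
  moreover have F: "(+) ?b -` E \<in> sets borel"
    using measurable_sets[OF borel_measurable_continuous_onI[of "(+) ?b"] E]
    by (simp add: continuous_on_add)
  ultimately have "measure \<mu> (lam ?b -` ((+) ?b -` E)) = measure \<mu> ((+) ?b -` E)"
    by (intro haar_automorphism_invariant[OF haar compact_space]) (auto simp: lam_add)
  also have "\<dots> = measure \<mu> E"
    using haar_left_invariant[OF haar E] by (simp add: vimage_def)
  also have "lam ?b -` ((+) ?b -` E) = circ a ` E"
    by (simp add: image_circ_eq_vimage circ_eq_add_lam[of ?b] vimage_def)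
  finally show ?thesis .
qed

lemma invariant_subgroupI:
  assumes haar: "haar_probability_measure \<mu>" and "subgroup_of circ e cinv H" and "closed H"
  shows "invariant_subgroup circ e cinv H \<mu>"
proof -
  interpret subgroup_of circ e cinv H by fact
  interpret prob_space \<mu>
    using haar by (simp add: haar_probability_measure_def)
  have sets: "sets \<mu> = sets borel"
    using haar by (simp add: haar_probability_measure_def regular_borel_measure_def)
  have H: "H \<in> sets borel"
    by (rule borel_closed) fact
  show ?thesis
  proof unfold_locales
    show "circ a ` H \<in> sets \<mu>" for a
      unfolding sets by (rule image_circ_borel[OF H])
    show "measure \<mu> (circ a ` H) = measure \<mu> H" for a
      by (rule haar_circ_invariant[OF haar H])
  qed
qed

lemma closed_Ann: "closed (Ann circ)"
  by (simp add: Ann_eq_Inter_Cb closed_Cb closed_INT)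

lemma Pair_vimage_commuting_pairs: "Pair x -` commuting_pairs circ = Cb circ x"
  by (auto simp: Cb_def commuting_pairs_def)

lemma haar_product:
  fixes \<mu> :: "'a measure"
  assumes haar: "haar_probability_measure \<mu>" and "regular_product_measure \<mu> \<mu> P"
  shows "compact_product_measure \<mu> \<mu> P"
proof -
  interpret prob_space \<mu>
    using haar by (simp add: haar_probability_measure_def)
  have inner: "inner_regular \<mu>"
    using haar by (intro regular_borel_imp_inner_regular) (auto simp: haar_probability_measure_def finite_measure_axioms)
  then have sets: "sets \<mu> = sets borel"
    by (simp add: inner_regular_def)
  have space: "space \<mu> = UNIV"
    using sets_eq_imp_space_eq[OF sets] by simp
  have P: "sets P = sets borel"
    "\<And>A B. A \<in> sets borel \<Longrightarrow> B \<in> sets borel \<Longrightarrow> emeasure P (A \<times> B) = emeasure \<mu> A * emeasure \<mu> B"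
    using assms(2) sets by (auto simp: regular_product_measure_def regular_borel_measure_def)
  have "space P = UNIV \<times> UNIV"
    using sets_eq_imp_space_eq[OF P(1)] by simp
  then have "emeasure P (space P) = 1"
    using P(2)[of UNIV UNIV] emeasure_space_1 space by simp
  then have finite: "finite_measure P"
    by (intro finite_measureI) simp
  show ?thesis
  proof (intro compact_product_measure.intro compact_product_measure_axioms.intro)
    show "measure P (A \<times> B) = measure \<mu> A * measure \<mu> B"
      if "A \<in> sets borel" "B \<in> sets borel" for A B
      using P(2)[OF that] by (simp add: measure_def enn2real_mult)
    show "compact (UNIV :: 'a set)"
      by (rule compact_space)
  qed (fact prob_space_axioms inner P(1) finite)+
qed

lemma measure_Cb_le_half:
  assumes "haar_probability_measure \<mu>" and "x \<notin> Ann circ"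
  shows "measure \<mu> (Cb circ x) \<le> 1 / 2"
proof -
  interpret invariant_subgroup circ e cinv "Cb circ x" \<mu>
    by (intro invariant_subgroupI assms subgroup_Cb closed_Cb)
  show ?thesis
    using assms Cb_eq_UNIV_iff by (intro measure_proper_subgroup_le_half) auto
qed

lemma Pb_le_measure_Ann:
  assumes "haar_probability_measure \<mu>" and "regular_product_measure \<mu> \<mu> P"
    and "\<And>x. x \<notin> Ann circ \<Longrightarrow> measure \<mu> (Cb circ x) \<le> t" and "0 \<le> t"
  shows "Pb circ P \<le> measure \<mu> (Ann circ) + t * (1 - measure \<mu> (Ann circ))"
proof -
  interpret compact_product_measure \<mu> \<mu> P
    by (intro haar_product assms)
  show ?thesis
    unfolding Pb_def using assms closed_Ann
    by (intro measure_le_by_slices closed_commuting_pairs)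
      (auto simp: Pair_vimage_commuting_pairs)
qed

text \<open>The set \<open>E\<close> below, rather than \<open>FCI\<close> itself, is used because its measurability is
  immediate: the superlevel sets of the measure of the slices are closed.\<close>

lemma Pb_le_half_if_FCI_proper:
  assumes haar: "haar_probability_measure \<mu>" and "regular_product_measure \<mu> \<mu> P"
    and "FCI circ \<noteq> UNIV"
  shows "Pb circ P \<le> 1 / 2"
proof -
  interpret compact_product_measure \<mu> \<mu> P
    by (intro haar_product assms)
  define E where "E = {x. 0 < measure \<mu> (Cb circ x)}"
  have "closed {x. t \<le> measure \<mu> (Cb circ x)}" for t
    using open_slice_less[OF closed_commuting_pairs, of t]
    by (simp add: Pair_vimage_commuting_pairs closed_def Collect_neg_eq[symmetric] not_le)
  moreover have "E = (\<Union>n. {x. 1 / real (Suc n) \<le> measure \<mu> (Cb circ x)})"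
  proof -
    have "0 < r \<longleftrightarrow> (\<exists>n. 1 / real (Suc n) \<le> r)" for r :: real
      by (metis inverse_eq_divide less_imp_le less_le_trans of_nat_0_less_iff reals_Archimedean
          zero_less_Suc zero_less_divide_1_iff)
    then show ?thesis
      by (auto simp: E_def)
  qed
  ultimately have E: "E \<in> sets borel"
    by (auto intro!: sets.countable_UN)
  have E_FCI: "E \<subseteq> FCI circ"
  proof
    fix x
    assume "x \<in> E"
    interpret invariant_subgroup circ e cinv "Cb circ x" \<mu>
      by (intro invariant_subgroupI assms subgroup_Cb closed_Cb)
    show "x \<in> FCI circ"
      using \<open>x \<in> E\<close> measure_infinite_index_eq_0 by (auto simp: E_def FCI_def)
  qed
  obtain g where "g \<notin> FCI circ"
    using assms by blast
  then have "E \<inter> circ g ` E = {}"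
    using FCI_of_circ E_FCI by blast
  then have "measure \<mu> (E \<union> circ g ` E) = measure \<mu> E + measure \<mu> (circ g ` E)"
    using E image_circ_borel by (intro M.finite_measure_Union) (auto simp: sets_M)
  then have "measure \<mu> E \<le> 1 / 2"
    using haar_circ_invariant[OF haar E, of g] M.prob_le_1[of "E \<union> circ g ` E"] by simp
  moreover have "Pb circ P \<le> measure \<mu> E + 0 * (1 - measure \<mu> E)"
    unfolding Pb_def using E
    by (intro measure_le_by_slices closed_commuting_pairs)
      (auto simp: Pair_vimage_commuting_pairs E_def not_less)
  ultimately show ?thesis
    by simp
qed

lemma measure_Ann_index:
  assumes "haar_probability_measure \<mu>" and "finite (Ann_quotient circ)"
  shows "measure \<mu> (Ann circ) = 1 / card (Ann_quotient circ)"
proof -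
  interpret invariant_subgroup circ e cinv "Ann circ" \<mu>
    by (intro invariant_subgroupI assms subgroup_Ann closed_Ann)
  have "sets \<mu> = sets borel"
    using assms by (simp add: haar_probability_measure_def regular_borel_measure_def)
  then have "space \<mu> = UNIV"
    using sets_eq_imp_space_eq[of \<mu> borel] by simp
  with assms have "card (left_cosets circ (Ann circ)) * measure \<mu> (Ann circ) = 1"
    by (intro card_left_cosets_mult_measure) (auto simp: Ann_quotient_eq)
  then show ?thesis
    unfolding Ann_quotient_eq
    by (cases "card (left_cosets circ (Ann circ)) = 0") (simp_all add: field_simps del: card_eq_0_iff)
qed

text \<open>The centralizer is a union of \<open>k\<close> cosets of the annihilator, each of measure \<open>1/3\<close>; as
  its measure is at most \<open>1/2\<close>, \<open>k \<le> 1\<close>.\<close>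

lemma measure_Cb_le_third:
  assumes "haar_probability_measure \<mu>" and "finite (Ann_quotient circ)" and "card (Ann_quotient circ) = 3"
    and "x \<notin> Ann circ"
  shows "measure \<mu> (Cb circ x) \<le> 1 / 3"
proof -
  interpret invariant_subgroup circ e cinv "Ann circ" \<mu>
    by (intro invariant_subgroupI assms subgroup_Ann closed_Ann)
  define k where "k = card {C \<in> left_cosets circ (Ann circ). C \<subseteq> Cb circ x}"
  have "measure \<mu> (Cb circ x) = k * measure \<mu> (Ann circ)"
    unfolding k_def using assms(2)
    by (intro measure_stable_set) (auto simp: Ann_quotient_eq Ann_eq_Inter_Cb intro: circ_mem_Cb)
  then have "measure \<mu> (Cb circ x) = k / 3"
    using measure_Ann_index assms by simp
  moreover from this have "k \<le> 1"
    using measure_Cb_le_half[OF assms(1,4)] by simp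
  ultimately show ?thesis
    by simp
qed

end

theorem theorem5p11:
  fixes circ :: "'a::{topological_group_add, t2_space} \<Rightarrow> 'a \<Rightarrow> 'a"
    and e :: 'a and cinv :: "'a \<Rightarrow> 'a"
    and \<mu> :: "'a measure" and \<mu>\<mu> :: "('a \<times> 'a) measure"
  assumes "compact_skew_left_brace circ e cinv"
    and "haar_probability_measure \<mu>"
    and "regular_product_measure \<mu> \<mu> \<mu>\<mu>"
  shows "(\<forall>x. x \<notin> Ann circ \<longrightarrow> measure \<mu> (Cb circ x) \<le> 1 / 2)
    \<and> (Ann circ \<noteq> UNIV \<longrightarrow> Pb circ \<mu>\<mu> \<le> 3 / 4)
    \<and> (\<forall>d::nat. finite (Ann_quotient circ) \<and> card (Ann_quotient circ) = d \<longrightarrow>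
          Pb circ \<mu>\<mu> \<le> (real d + 1) / (2 * real d))
    \<and> (\<forall>d::nat. finite (Ann_quotient circ) \<and> card (Ann_quotient circ) = d \<and> d \<ge> 3 \<longrightarrow>
          Pb circ \<mu>\<mu> \<le> 5 / 8)
    \<and> (FCI circ \<noteq> UNIV \<longrightarrow> Pb circ \<mu>\<mu> \<le> 1 / 2)"
proof -
  interpret compact_skew_left_brace circ e cinv
    by fact
  note haar = assms(2) and prod = assms(3)
  have half: "measure \<mu> (Cb circ x) \<le> 1 / 2" if "x \<notin> Ann circ" for x
    using measure_Cb_le_half[OF haar that] .
  have Pb_half: "Pb circ \<mu>\<mu> \<le> (1 + measure \<mu> (Ann circ)) / 2"
    using Pb_le_measure_Ann[OF haar prod half] by (simp add: field_simps)
  have three_quarters: "Pb circ \<mu>\<mu> \<le> 3 / 4" if "Ann circ \<noteq> UNIV"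
  proof -
    interpret invariant_subgroup circ e cinv "Ann circ" \<mu>
      by (intro invariant_subgroupI haar subgroup_Ann closed_Ann)
    show ?thesis
      using measure_proper_subgroup_le_half[OF that] Pb_half by simp
  qed
  have index: "Pb circ \<mu>\<mu> \<le> (real d + 1) / (2 * real d)"
    if d: "finite (Ann_quotient circ)" "card (Ann_quotient circ) = d" for d
  proof -
    have "d > 0"
      using d by (auto simp: card_gt_0_iff Ann_quotient_def left_cosets_def)
    then show ?thesis
      using Pb_half measure_Ann_index[OF haar d(1)] d(2) by (simp add: field_simps)
  qed
  have five_eighths: "Pb circ \<mu>\<mu> \<le> 5 / 8"
    if d: "finite (Ann_quotient circ)" "card (Ann_quotient circ) = d" "d \<ge> 3" for d
  proof (cases "d = 3")
    case True
    \<comment> \<open>For \<open>d = 3\<close> the bound \<open>(d + 1) / (2 * d)\<close> is only \<open>2/3\<close>.\<close>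
    have "Pb circ \<mu>\<mu> \<le> 1 / 3 + 1 / 3 * (1 - 1 / 3)"
      using Pb_le_measure_Ann[OF haar prod measure_Cb_le_third[OF haar d(1)]]
        measure_Ann_index[OF haar d(1)] d(2) True by simp
    then show ?thesis
      by simp
  next
    case False
    with d(3) have "(real d + 1) / (2 * real d) \<le> 5 / 8"
      by (simp add: field_simps)
    with index[OF d(1,2)] show ?thesis
      by (rule order_trans)
  qed
  show ?thesis
    using half three_quarters index five_eighths Pb_le_half_if_FCI_proper[OF haar prod] by blast
qed

end
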